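(* Let $\nu$ be a (nonskew) diagram. The image of the supersymmetric Schur function $s_\nu(x/y\|a)$ under the isomorphism $\Lambda(x/y\|a)\to\Lambda(x\|a)$ given by the evaluation $y_i\mapsto -a_i$ for all $i\geqslant 1$ coincides with the double Schur function $s_\nu(x\|a)$; that is, $$s_\nu(x/y\|a)\big|_{y=-a}=s_\nu(x\|a),$$ where $y=-a$ denotes the evaluation $y_i=-a_i$ for $i\geqslant 1$.
   Context: Let $a=(a_i)_{i\in\mathbb Z}$ be a sequence of commuting indeterminates and $\mathbb Q[a]$ the polynomial ring in the $a_i$. The ring $\Lambda(x\|a)$: its elements are sequences $P=(P_0,P_1,P_2,\dots)$, where $P_n$ is a symmetric polynomial in $x_1,\dots,x_n$ with coefficients in $\mathbb Q[a]$, the total degrees of the $P_n$ in the $x_i$ are bounded, and $P_n(x_1,\dots,x_{n-1},a_n)=P_{n-1}(x_1,\dots,x_{n-1})$ for all $n\geqslant 1$; multiplication is componentwise. It is freely generated over $\mathbb Q[a]$ by the double power sums $p_k(x\|a)=\sum_{i\geqslant 1}(x_i^k-a_i^k)$, $k\geqslant 1$. Double Schur functions: for a partition $\lambda$ with $\ell(\lambda)\leqslant n$, $$s_\lambda(x_1,\dots,x_n\|a)=\frac{\det\big[(x_i\|a)^{\lambda_j+n-j}\big]_{i,j=1}^n}{\prod_{1\leqslant i<j\leqslant n}(x_i-x_j)},\qquad (x_i\|a)^r=(x_i-a_n)(x_i-a_{n-1})\cdots(x_i-a_{n-r+1}),\ (x_i\|a)^0=1,$$ and $0$ if $\ell(\lambda)>n$.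 This sequence is $s_\lambda(x\|a)\in\Lambda(x\|a)$. Supersymmetric functions: $\Lambda(x/y\|a)$ is the ring generated over $\mathbb Q[a]$ by $p_k(x/y)=\sum_{i\geqslant 1}\big(x_i^k+(-1)^{k-1}y_i^k\big)$, $k\geqslant 1$. The evaluation $y_i\mapsto -a_i$ sends $p_k(x/y)$ to $p_k(x\|a)$ and defines a ring isomorphism $\Lambda(x/y\|a)\to\Lambda(x\|a)$. Supersymmetric Schur functions: for $x=(x_1,\dots,x_n)$, $y=(y_1,\dots,y_n)$ and a skew diagram $\nu/\mu$ set $$s_{\nu/\mu}(x/y\|a)=\sum_{\mu\subseteq\rho\subseteq\nu}\widetilde s_{\nu/\rho}(x\|a)\,s_{\rho'/\mu'}(y\,|\,{-}a),$$ where $\widetilde s_\theta(x\|a)=\sum_T\prod_{\alpha\in\theta}(x_{T(\alpha)}-a_{T(\alpha)-c(\alpha)})$ over reverse $\theta$-tableaux $T$ with entries in $\{1,\dots,n\}$ (weakly decreasing along rows, strictly decreasing down columns), and $s_\theta(y\,|\,{-}a)=\sum_T\prod_{\alpha\in\theta}(y_{T(\alpha)}+a_{T(\alpha)+c(\alpha)})$ over semistandard $\theta$-tableaux $T$ with entries in $\{1,\dots,n\}$ (weakly increasing along rows, strictly increasing down columns). Here $c(\alpha)=j-i$ for the box $\alpha=(i,j)$ in row $i$, column $j$, and primes denote conjugate diagrams. These polynomials are consistent with the evaluations $x_n=y_n=0$ and so define elements $s_{\nu/\mu}(x/y\|a)\in\Lambda(x/y\|a)$ in infinitely many variables; $s_\nu=s_{\nu/\varnothing}$.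 *)

theory Defs
  imports "HOL-Library.Poly_Mapping" "Jordan_Normal_Form.Determinant"
begin

section \<open>Polynomial rings\<close>

text \<open>
  Polynomials with coefficients in \<open>'c\<close> and indeterminates indexed by \<open>'v\<close> are finitely
  supported maps from monomials to coefficients; a monomial maps each indeterminate to its exponent.
\<close>

type_synonym ('v, 'c) mpol = "('v \<Rightarrow>\<^sub>0 nat) \<Rightarrow>\<^sub>0 'c"

definition pvar :: "'v \<Rightarrow> ('v, 'c::comm_ring_1) mpol" where
  "pvar v = Poly_Mapping.single (Poly_Mapping.single v 1) 1"

definition pconst :: "'c::comm_ring_1 \<Rightarrow> ('v, 'c) mpol" where
  "pconst c = Poly_Mapping.single 0 c"

definition monom_eval :: "('v \<Rightarrow> ('w, 'c::comm_ring_1) mpol) \<Rightarrow> ('v \<Rightarrow>\<^sub>0 nat) \<Rightarrow> ('w, 'c) mpol" where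
  "monom_eval f m = (\<Prod>v\<in>Poly_Mapping.keys m. f v ^ Poly_Mapping.lookup m v)"

text \<open>Simultaneous substitution of the polynomials \<open>f v\<close> for the indeterminates \<open>v\<close>.\<close>

definition psubst :: "('v \<Rightarrow> ('w, 'c::comm_ring_1) mpol) \<Rightarrow> ('v, 'c) mpol \<Rightarrow> ('w, 'c) mpol" where
  "psubst f p = (\<Sum>m\<in>Poly_Mapping.keys p. pconst (Poly_Mapping.lookup p m) * monom_eval f m)"

definition pvars :: "('v, 'c::comm_ring_1) mpol \<Rightarrow> 'v set" where
  "pvars p = (\<Union>m\<in>Poly_Mapping.keys p. Poly_Mapping.keys m)"

definition monom_degree :: "('v \<Rightarrow>\<^sub>0 nat) \<Rightarrow> nat" where
  "monom_degree m = (\<Sum>v\<in>Poly_Mapping.keys m. Poly_Mapping.lookup m v)"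

text \<open>The coefficient ring \<open>\<rat>[a]\<close> in the indeterminates \<open>a\<^sub>i\<close>, \<open>i \<in> \<int>\<close>.\<close>

type_synonym Qa = "(int, rat) mpol"

definition avar :: "int \<Rightarrow> Qa" where
  "avar i = pvar i"

text \<open>
  Level \<open>n\<close> of \<open>\<Lambda>(x||a)\<close> lives in \<open>(nat, Qa) mpol\<close>, where the indeterminate \<open>i \<ge> 1\<close>
  is \<open>x\<^sub>i\<close>; level \<open>n\<close> of \<open>\<Lambda>(x/y||a)\<close> lives in \<open>(xy, Qa) mpol\<close>.
\<close>

datatype xy = X nat | Y nat

type_synonym x_seq = "nat \<Rightarrow> (nat, Qa) mpol"
type_synonym xy_seq = "nat \<Rightarrow> (xy, Qa) mpol"


section \<open>The rings \<open>\<Lambda>(x||a)\<close> and \<open>\<Lambda>(x/y||a)\<close>\<close>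

definition Lambda_double :: "x_seq set" where
  "Lambda_double = {P.
     (\<forall>n. pvars (P n) \<subseteq> {1..n}) \<and>
     (\<forall>n \<pi>. \<pi> permutes {1..n} \<longrightarrow> psubst (\<lambda>i. pvar (\<pi> i)) (P n) = P n) \<and>
     (\<exists>d. \<forall>n. \<forall>m\<in>Poly_Mapping.keys (P n). monom_degree m \<le> d) \<and>
     (\<forall>n\<ge>1. psubst (pvar(n := pconst (avar (int n)))) (P n) = P (n - 1))}"

definition p_double :: "nat \<Rightarrow> x_seq" where
  "p_double k n = (\<Sum>i=1..n. pvar i ^ k - pconst (avar (int i)) ^ k)"

text \<open>
  An element in infinitely many variables is given by its images \<open>P n\<close> in
  \<open>x\<^sub>1, \<dots>, x\<^sub>n, y\<^sub>1, \<dots>, y\<^sub>n\<close> (all further variables being set to \<open>0\<close>).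
\<close>

definition p_super :: "nat \<Rightarrow> xy_seq" where
  "p_super k n = (\<Sum>i=1..n. pvar (X i) ^ k + (- 1) ^ (k - 1) * pvar (Y i) ^ k)"

inductive_set Lambda_super :: "xy_seq set" where
  const: "(\<lambda>n. pconst c) \<in> Lambda_super"
| p_super: "k \<ge> 1 \<Longrightarrow> p_super k \<in> Lambda_super"
| add: "P \<in> Lambda_super \<Longrightarrow> Q \<in> Lambda_super \<Longrightarrow> (\<lambda>n. P n + Q n) \<in> Lambda_super"
| mult: "P \<in> Lambda_super \<Longrightarrow> Q \<in> Lambda_super \<Longrightarrow> (\<lambda>n. P n * Q n) \<in> Lambda_super"

text \<open>
  The evaluation \<open>y\<^sub>i \<mapsto> -a\<^sub>i\<close> for all \<open>i \<ge> 1\<close>.  It acts at each level; on supersymmetric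
  sequences this is compatible with the transition maps, since putting \<open>x\<^sub>n = a\<^sub>n\<close>,
  \<open>y\<^sub>n = -a\<^sub>n\<close> cancels both variables.
  The lemmas at the end of the theory show that it restricts to a \<open>\<rat>[a]\<close>-algebra homomorphism
  \<open>\<Lambda>(x/y||a) \<rightarrow> \<Lambda>(x||a)\<close>, the only one sending each \<open>p\<^sub>k(x/y)\<close> to \<open>p\<^sub>k(x||a)\<close>.
\<close>

definition eval_y_minus_a :: "xy_seq \<Rightarrow> x_seq" where
  "eval_y_minus_a P n =
     psubst (\<lambda>v. case v of X i \<Rightarrow> pvar i | Y i \<Rightarrow> - pconst (avar (int i))) (P n)"


section \<open>Partitions and diagrams\<close>

text \<open>
  Rows and columns are counted from \<open>0\<close>: \<open>lam i\<close> is the part usually denoted by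
  \<open>\<lambda>\<close> with subscript \<open>i + 1\<close>. The content \<open>j - i\<close> of a box is unaffected.
\<close>

definition is_partition :: "(nat \<Rightarrow> nat) \<Rightarrow> bool" where
  "is_partition lam \<longleftrightarrow> antimono lam \<and> finite {i. lam i \<noteq> 0}"

definition part_length :: "(nat \<Rightarrow> nat) \<Rightarrow> nat" where
  "part_length lam = card {i. lam i \<noteq> 0}"

definition diagram :: "(nat \<Rightarrow> nat) \<Rightarrow> (nat \<times> nat) set" where
  "diagram lam = {(i, j). j < lam i}"

definition content :: "nat \<times> nat \<Rightarrow> int" where
  "content b = int (snd b) - int (fst b)"


section \<open>Double Schur functions\<close>

text \<open>\<open>shifted_power n i r\<close> is \<open>(x\<^sub>i||a)\<^sup>r = (x\<^sub>i - a\<^sub>n) \<cdots> (x\<^sub>i - a\<^bsub>n-r+1\<^esub>)\<close>.\<close>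

definition shifted_power :: "nat \<Rightarrow> nat \<Rightarrow> nat \<Rightarrow> (nat, Qa) mpol" where
  "shifted_power n i r = (\<Prod>k<r. pvar i - pconst (avar (int n - int k)))"

definition vandermonde :: "nat \<Rightarrow> (nat, Qa) mpol" where
  "vandermonde n = (\<Prod>(i, j)\<in>{(i, j). 1 \<le> i \<and> i < j \<and> j \<le> n}. pvar i - pvar j)"

text \<open>
  The quotient of the determinant by the Vandermonde product is the exact quotient in the
  polynomial ring, which is an integral domain. Matrix indices run over \<open>0, \<dots>, n - 1\<close>.
\<close>

definition double_schur :: "(nat \<Rightarrow> nat) \<Rightarrow> x_seq" where
  "double_schur lam n =
     (if part_length lam \<le> n
      then THE q. q * vandermonde n
             = det (mat n n (\<lambda>(i, j). shifted_power n (i + 1) (lam j + n - (j + 1))))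
      else 0)"


section \<open>Supersymmetric Schur functions\<close>

text \<open>
  Tableaux of shape \<open>D\<close> are functions on \<open>D\<close>, extended by \<open>undefined\<close> outside \<open>D\<close>.
\<close>

definition reverse_tableaux :: "nat \<Rightarrow> (nat \<times> nat) set \<Rightarrow> (nat \<times> nat \<Rightarrow> nat) set" where
  "reverse_tableaux n D = {T \<in> D \<rightarrow>\<^sub>E {1..n}.
     (\<forall>i j j'. (i, j) \<in> D \<and> (i, j') \<in> D \<and> j < j' \<longrightarrow> T (i, j') \<le> T (i, j)) \<and>
     (\<forall>i i' j. (i, j) \<in> D \<and> (i', j) \<in> D \<and> i < i' \<longrightarrow> T (i', j) < T (i, j))}"

definition semistandard_tableaux :: "nat \<Rightarrow> (nat \<times> nat) set \<Rightarrow> (nat \<times> nat \<Rightarrow> nat) set" where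
  "semistandard_tableaux n D = {T \<in> D \<rightarrow>\<^sub>E {1..n}.
     (\<forall>i j j'. (i, j) \<in> D \<and> (i, j') \<in> D \<and> j < j' \<longrightarrow> T (i, j) \<le> T (i, j')) \<and>
     (\<forall>i i' j. (i, j) \<in> D \<and> (i', j) \<in> D \<and> i < i' \<longrightarrow> T (i, j) < T (i', j))}"

text \<open>\<open>schur_tilde_x D\<close> and \<open>schur_y D\<close> are the sums written
  s-tilde of \<open>(x||a)\<close> (with index \<open>\<theta>\<close>) and \<open>s\<^sub>\<theta>(y|-a)\<close> for the skew diagram \<open>\<theta> = D\<close>.\<close>

definition schur_tilde_x :: "(nat \<times> nat) set \<Rightarrow> xy_seq" where
  "schur_tilde_x D n = (\<Sum>T\<in>reverse_tableaux n D. \<Prod>b\<in>D.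
     pvar (X (T b)) - pconst (avar (int (T b) - content b)))"

definition schur_y :: "(nat \<times> nat) set \<Rightarrow> xy_seq" where
  "schur_y D n = (\<Sum>T\<in>semistandard_tableaux n D. \<Prod>b\<in>D.
     pvar (Y (T b)) + pconst (avar (int (T b) + content b)))"

text \<open>The diagram of a conjugate partition is the converse relation of the diagram.\<close>

definition super_schur_skew :: "(nat \<Rightarrow> nat) \<Rightarrow> (nat \<Rightarrow> nat) \<Rightarrow> xy_seq" where
  "super_schur_skew nu mu n =
     (\<Sum>rho | is_partition rho \<and> diagram mu \<subseteq> diagram rho \<and> diagram rho \<subseteq> diagram nu.
        schur_tilde_x (diagram nu - diagram rho) n *
        schur_y ((diagram rho)\<inverse> - (diagram mu)\<inverse>) n)"

definition super_schur :: "(nat \<Rightarrow> nat) \<Rightarrow> xy_seq" where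
  "super_schur nu = super_schur_skew nu (\<lambda>_. 0)"


section \<open>The evaluation as a homomorphism \<open>\<Lambda>(x/y||a) \<rightarrow> \<Lambda>(x||a)\<close>\<close>

lemma monom_eval_superset:
  assumes "finite A" "Poly_Mapping.keys m \<subseteq> A"
  shows "monom_eval f m = (\<Prod>v\<in>A. f v ^ Poly_Mapping.lookup m v)"
  unfolding monom_eval_def
  by (rule prod.mono_neutral_left) (use assms in \<open>auto simp: in_keys_iff\<close>)

lemma monom_eval_0 [simp]: "monom_eval f 0 = 1"
  by (simp add: monom_eval_def)

lemma monom_eval_single [simp]: "monom_eval f (Poly_Mapping.single v k) = f v ^ k"
  by (subst monom_eval_superset[of "{v}"]) auto

lemma monom_eval_add: "monom_eval f (m + m') = monom_eval f m * monom_eval f m'"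
proof -
  let ?A = "Poly_Mapping.keys m \<union> Poly_Mapping.keys m'"
  have "monom_eval f (m + m') = (\<Prod>v\<in>?A. f v ^ Poly_Mapping.lookup (m + m') v)"
    by (rule monom_eval_superset) (auto dest: subsetD[OF keys_add])
  also have "\<dots> = (\<Prod>v\<in>?A. f v ^ Poly_Mapping.lookup m v) * (\<Prod>v\<in>?A. f v ^ Poly_Mapping.lookup m' v)"
    by (simp add: lookup_add power_add prod.distrib)
  also have "\<dots> = monom_eval f m * monom_eval f m'"
    by (simp add: monom_eval_superset[of ?A])
  finally show ?thesis .
qed

lemma pconst_0 [simp]: "pconst 0 = 0"
  and pconst_1 [simp]: "pconst 1 = 1"
  and pconst_add: "pconst (c + d) = pconst c + pconst d"
  and pconst_mult: "pconst (c * d) = pconst c * pconst d"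
  and pconst_uminus: "pconst (- c) = - pconst c"
  by (simp_all add: pconst_def single_add mult_single single_uminus)

lemma psubst_superset:
  assumes "finite A" "Poly_Mapping.keys p \<subseteq> A"
  shows "psubst f p = (\<Sum>m\<in>A. pconst (Poly_Mapping.lookup p m) * monom_eval f m)"
  unfolding psubst_def
  by (rule sum.mono_neutral_left) (use assms in \<open>auto simp: in_keys_iff\<close>)

lemma psubst_0 [simp]: "psubst f 0 = 0"
  by (simp add: psubst_def)

lemma psubst_single: "psubst f (Poly_Mapping.single m c) = pconst c * monom_eval f m"
  by (subst psubst_superset[of "{m}"]) auto

lemma psubst_pconst [simp]: "psubst f (pconst c) = pconst c"
  by (simp add: pconst_def[of c] psubst_single)

lemma psubst_1 [simp]: "psubst f 1 = 1"
  using psubst_pconst[of f 1] by simp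

lemma psubst_pvar [simp]: "psubst f (pvar v) = f v"
  by (simp add: pvar_def psubst_single)

lemma psubst_add: "psubst f (p + q) = psubst f p + psubst f q"
proof -
  let ?A = "Poly_Mapping.keys p \<union> Poly_Mapping.keys q"
  have "psubst f (p + q) = (\<Sum>m\<in>?A. pconst (Poly_Mapping.lookup (p + q) m) * monom_eval f m)"
    by (rule psubst_superset) (auto dest: subsetD[OF keys_add])
  then show ?thesis
    by (simp add: psubst_superset[of ?A] lookup_add pconst_add algebra_simps sum.distrib)
qed

lemma psubst_sum: "psubst f (\<Sum>i\<in>I. p i) = (\<Sum>i\<in>I. psubst f (p i))"
  by (induction I rule: infinite_finite_induct) (simp_all add: psubst_add)

lemma mpol_eq_sum_single:
  "p = (\<Sum>m\<in>Poly_Mapping.keys p. Poly_Mapping.single m (Poly_Mapping.lookup p m))"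
proof (rule poly_mapping_eqI)
  fix k
  have "Poly_Mapping.lookup (\<Sum>m\<in>Poly_Mapping.keys p. Poly_Mapping.single m (Poly_Mapping.lookup p m)) k
      = (\<Sum>m\<in>Poly_Mapping.keys p. if m = k then Poly_Mapping.lookup p m else 0)"
    by (simp add: lookup_sum lookup_single when_def)
  then show "Poly_Mapping.lookup p k =
      Poly_Mapping.lookup (\<Sum>m\<in>Poly_Mapping.keys p. Poly_Mapping.single m (Poly_Mapping.lookup p m)) k"
    by (simp add: in_keys_iff)
qed

lemma psubst_mult: "psubst f (p * q) = psubst f p * psubst f q"
proof -
  have single: "psubst f (Poly_Mapping.single m c * Poly_Mapping.single m' c')
      = psubst f (Poly_Mapping.single m c) * psubst f (Poly_Mapping.single m' c')" for m m' c c'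
    by (simp add: mult_single psubst_single pconst_mult monom_eval_add algebra_simps)
  let ?s = "\<lambda>p m. Poly_Mapping.single m (Poly_Mapping.lookup p m)"
  have "psubst f (p * q) =
      psubst f ((\<Sum>m\<in>Poly_Mapping.keys p. ?s p m) * (\<Sum>m\<in>Poly_Mapping.keys q. ?s q m))"
    using mpol_eq_sum_single[of p] mpol_eq_sum_single[of q] by simp
  also have "\<dots> = psubst f (\<Sum>m\<in>Poly_Mapping.keys p. ?s p m) * psubst f (\<Sum>m\<in>Poly_Mapping.keys q. ?s q m)"
    by (simp add: sum_product psubst_sum single)
  also have "\<dots> = psubst f p * psubst f q"
    using mpol_eq_sum_single[of p] mpol_eq_sum_single[of q] by simp
  finally show ?thesis .
qed

lemma psubst_power: "psubst f (p ^ k) = psubst f p ^ k"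
  by (induction k) (simp_all add: psubst_mult)

lemma psubst_uminus: "psubst f (- p) = - psubst f p"
  using psubst_add[of f p "- p"] by (simp add: eq_neg_iff_add_eq_0 add.commute)

lemma psubst_diff: "psubst f (p - q) = psubst f p - psubst f q"
  using psubst_add[of f p "- q"] by (simp add: psubst_uminus)

lemma eval_y_minus_a_pconst: "eval_y_minus_a (\<lambda>n. pconst c) = (\<lambda>n. pconst c)"
  by (simp add: eval_y_minus_a_def fun_eq_iff)

lemma eval_y_minus_a_add:
  "eval_y_minus_a (\<lambda>n. P n + Q n) = (\<lambda>n. eval_y_minus_a P n + eval_y_minus_a Q n)"
  by (simp add: eval_y_minus_a_def fun_eq_iff psubst_add)

lemma eval_y_minus_a_mult:
  "eval_y_minus_a (\<lambda>n. P n * Q n) = (\<lambda>n. eval_y_minus_a P n * eval_y_minus_a Q n)"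
  by (simp add: eval_y_minus_a_def fun_eq_iff psubst_mult)

lemma eval_y_minus_a_p_super:
  assumes "k \<ge> 1"
  shows "eval_y_minus_a (p_super k) = p_double k"
proof
  fix n
  obtain l where k: "k = Suc l" using assms by (cases k) auto
  have sgn: "(- 1) ^ l * (- c) ^ Suc l = - (c ^ Suc l)" for c :: "(nat, Qa) mpol"
  proof -
    have "(- 1) ^ l * (- c) ^ Suc l = - (((- 1) * (- 1)) ^ l * c ^ Suc l)"
      unfolding power_minus[of c "Suc l"] power_mult_distrib by (simp add: algebra_simps)
    then show ?thesis by simp
  qed
  show "eval_y_minus_a (p_super k) n = p_double k n"
    unfolding eval_y_minus_a_def p_super_def p_double_def psubst_sum k
    by (intro sum.cong refl)
       (simp only: psubst_add psubst_mult psubst_power psubst_uminus psubst_1 psubst_pvar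
          xy.case diff_Suc_1 sgn, simp)
qed

lemma eval_y_minus_a_unique:
  assumes "\<And>c. \<phi> (\<lambda>n. pconst c) = (\<lambda>n. pconst c)"
    and "\<And>P Q. P \<in> Lambda_super \<Longrightarrow> Q \<in> Lambda_super \<Longrightarrow> \<phi> (\<lambda>n. P n + Q n) = (\<lambda>n. \<phi> P n + \<phi> Q n)"
    and "\<And>P Q. P \<in> Lambda_super \<Longrightarrow> Q \<in> Lambda_super \<Longrightarrow> \<phi> (\<lambda>n. P n * Q n) = (\<lambda>n. \<phi> P n * \<phi> Q n)"
    and "\<And>k. k \<ge> 1 \<Longrightarrow> \<phi> (p_super k) = p_double k"
    and "P \<in> Lambda_super"
  shows "\<phi> P = eval_y_minus_a P"
  using assms(5)
  by induction
     (simp_all add: assms(1-4) eval_y_minus_a_pconst eval_y_minus_a_add eval_y_minus_a_mult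
        eval_y_minus_a_p_super)

lemma pvars_pconst [simp]: "pvars (pconst c) = {}"
  by (auto simp: pvars_def pconst_def split: if_splits)

lemma pvars_pvar: "pvars (pvar v :: ('v, 'c::comm_ring_1) mpol) \<subseteq> {v}"
  by (auto simp: pvars_def pvar_def split: if_splits)

lemma pvars_add: "pvars (p + q) \<subseteq> pvars p \<union> pvars q"
  unfolding pvars_def using keys_add[of p q] by blast

lemma pvars_uminus [simp]: "pvars (- p) = pvars p"
  by (simp add: pvars_def in_keys_iff set_eq_iff)

lemma pvars_mult: "pvars (p * q) \<subseteq> pvars p \<union> pvars q"
proof
  fix v assume "v \<in> pvars (p * q)"
  then obtain m m' where "m \<in> Poly_Mapping.keys p" "m' \<in> Poly_Mapping.keys q"
    "v \<in> Poly_Mapping.keys (m + m')"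
    using keys_mult[of p q] by (fastforce simp: pvars_def)
  then show "v \<in> pvars p \<union> pvars q"
    using keys_add[of m m'] by (auto simp: pvars_def)
qed

lemma monom_degree_superset:
  assumes "finite A" "Poly_Mapping.keys m \<subseteq> A"
  shows "monom_degree m = (\<Sum>v\<in>A. Poly_Mapping.lookup m v)"
  unfolding monom_degree_def
  by (rule sum.mono_neutral_left) (use assms in \<open>auto simp: in_keys_iff\<close>)

lemma monom_degree_add: "monom_degree (m + m') = monom_degree m + monom_degree m'"
proof -
  let ?A = "Poly_Mapping.keys m \<union> Poly_Mapping.keys m'"
  have "monom_degree (m + m') = (\<Sum>v\<in>?A. Poly_Mapping.lookup (m + m') v)"
    by (rule monom_degree_superset) (auto dest: subsetD[OF keys_add])
  then show ?thesis
    by (simp add: monom_degree_superset[of ?A] lookup_add sum.distrib)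
qed

abbreviation deg_le :: "('v, 'c::comm_ring_1) mpol \<Rightarrow> nat \<Rightarrow> bool" where
  "deg_le p d \<equiv> \<forall>m\<in>Poly_Mapping.keys p. monom_degree m \<le> d"

lemma deg_le_add: "deg_le p d \<Longrightarrow> deg_le q d \<Longrightarrow> deg_le (p + q) d"
  using keys_add[of p q] by blast

lemma deg_le_mult: "deg_le p d \<Longrightarrow> deg_le q e \<Longrightarrow> deg_le (p * q) (d + e)"
  using keys_mult[of p q] by (fastforce simp: monom_degree_add intro: add_mono)

lemma deg_le_pconst: "deg_le (pconst c) d"
  by (auto simp: pconst_def monom_degree_def split: if_splits)

lemma Lambda_double_pconst: "(\<lambda>n. pconst c) \<in> Lambda_double"
  using deg_le_pconst by (auto simp: Lambda_double_def)

lemma Lambda_double_add: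
  assumes P: "P \<in> Lambda_double" and Q: "Q \<in> Lambda_double"
  shows "(\<lambda>n. P n + Q n) \<in> Lambda_double"
proof -
  from P obtain d where d: "\<And>n. deg_le (P n) d" by (auto simp: Lambda_double_def)
  from Q obtain e where e: "\<And>n. deg_le (Q n) e" by (auto simp: Lambda_double_def)
  have "deg_le (P n + Q n) (max d e)" for n
    by (rule deg_le_add) (use d e in \<open>fastforce simp: le_max_iff_disj\<close>)+
  moreover have "pvars (P n + Q n) \<subseteq> {1..n}" for n
    using P Q pvars_add[of "P n" "Q n"] by (fastforce simp: Lambda_double_def)
  ultimately show ?thesis
    using P Q by (auto simp: Lambda_double_def psubst_add)
qed

lemma Lambda_double_mult:
  assumes P: "P \<in> Lambda_double" and Q: "Q \<in> Lambda_double"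
  shows "(\<lambda>n. P n * Q n) \<in> Lambda_double"
proof -
  from P obtain d where d: "\<And>n. deg_le (P n) d" by (auto simp: Lambda_double_def)
  from Q obtain e where e: "\<And>n. deg_le (Q n) e" by (auto simp: Lambda_double_def)
  have "deg_le (P n * Q n) (d + e)" for n
    by (rule deg_le_mult) (use d e in auto)
  moreover have "pvars (P n * Q n) \<subseteq> {1..n}" for n
    using P Q pvars_mult[of "P n" "Q n"] by (fastforce simp: Lambda_double_def)
  ultimately show ?thesis
    using P Q by (auto simp: Lambda_double_def psubst_mult)
qed

lemma Lambda_double_p_double: "p_double k \<in> Lambda_double"
proof -
  define t :: "nat \<Rightarrow> (nat, Qa) mpol" where "t i = pvar i ^ k - pconst (avar (int i)) ^ k" for i
  have p: "p_double k n = (\<Sum>i=1..n. t i)" for n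
    by (simp add: p_double_def t_def)
  have pow: "pconst c ^ k = pconst (c ^ k)" for c :: Qa
    by (induction k) (simp_all add: pconst_mult)
  have t': "t i = pvar i ^ k + pconst (- (avar (int i) ^ k))" for i
    by (simp add: t_def pow pconst_uminus)
  have vpow: "pvars (pvar i ^ k :: (nat, Qa) mpol) \<subseteq> {i}" for i
  proof (induction k)
    case 0
    show ?case by (simp add: pvars_def)
  next
    case (Suc k)
    then show ?case using pvars_mult[of "pvar i :: (nat, Qa) mpol" "pvar i ^ k"] pvars_pvar[of i]
      by fastforce
  qed
  have vt: "pvars (t i) \<subseteq> {i}" for i
    using pvars_add[of "pvar i ^ k" "pconst (- (avar (int i) ^ k))"] vpow[of i]
    by (fastforce simp: t')
  have "deg_le (pvar i ^ k :: (nat, Qa) mpol) k" for i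
  proof (induction k)
    case 0
    show ?case by (simp add: monom_degree_def)
  next
    case (Suc k)
    have "deg_le (pvar i :: (nat, Qa) mpol) 1"
      by (auto simp: pvar_def monom_degree_def split: if_splits)
    from deg_le_mult[OF this Suc] show ?case by simp
  qed
  then have dt: "deg_le (t i) k" for i
    unfolding t' by (intro deg_le_add deg_le_pconst)
  have 1: "pvars (p_double k n) \<subseteq> {1..n}" for n
    unfolding p
  proof (induction n)
    case 0
    then show ?case by (simp add: pvars_def)
  next
    case (Suc n)
    then show ?case using pvars_add[of "\<Sum>i=1..n. t i" "t (Suc n)"] vt[of "Suc n"] by fastforce
  qed
  have 2: "deg_le (p_double k n) k" for n
    unfolding p
  proof (induction n)
    case (Suc n)
    have "deg_le ((\<Sum>i=1..n. t i) + t (Suc n)) k"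
      by (rule deg_le_add[OF Suc dt])
    then show ?case by simp
  qed simp
  have 3: "psubst (\<lambda>i. pvar (\<pi> i)) (p_double k n) = p_double k n" if "\<pi> permutes {1..n}" for \<pi> n
    using sum.permute[OF that, of "\<lambda>i. pvar i ^ k :: (nat, Qa) mpol", symmetric]
    by (simp add: p_double_def psubst_sum psubst_diff psubst_power sum_subtractf o_def)
  have 4: "psubst (pvar(n := pconst (avar (int n)))) (p_double k n) = p_double k (n - 1)"
    if n: "n \<ge> 1" for n
  proof -
    obtain l where l: "n = Suc l" using n by (cases n) auto
    show ?thesis unfolding l
      by (simp add: p_double_def psubst_sum psubst_diff psubst_add psubst_power)
  qed
  show ?thesis unfolding Lambda_double_def using 1 2 3 4 by blast
qed

lemma eval_y_minus_a_in_Lambda_double: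
  "P \<in> Lambda_super \<Longrightarrow> eval_y_minus_a P \<in> Lambda_double"
  by (induction rule: Lambda_super.induct)
     (simp_all add: eval_y_minus_a_pconst eval_y_minus_a_add eval_y_minus_a_mult
        eval_y_minus_a_p_super Lambda_double_pconst Lambda_double_add Lambda_double_mult
        Lambda_double_p_double)

end

theory Submission
  imports Defs
begin

text \<open>
  After \<open>y\<^sub>i \<mapsto> -a\<^sub>i\<close>, every \<open>y\<close>-factor with nonempty \<open>\<rho>\<close> vanishes, so only the sum over reverse
  \<open>\<nu>\<close>-tableaux survives, and the claim becomes the equality of this tableau sum with the ratio of
  determinants. It holds over any commutative ring and is proved by induction on \<open>n\<close>.
  Erasing the entries \<open>1\<close> of a tableau leaves a tableau on a shape \<open>\<rho>\<close> interlacing \<open>\<lambda>\<close>, hence a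
  branching rule. The determinant obeys the same rule: subtracting from each column the
  multiple of the next one that clears the row of \<open>x\<^sub>1\<close> makes the entry in row \<open>i\<close> divisible by \<open>x\<^sub>i - x\<^sub>1\<close>,
  the quotient being a telescoping sum over exactly those interlacing \<open>\<rho>\<close>; one then
  expands along the first row and by multilinearity in the columns. The shift \<open>a\<^sub>i \<mapsto> a\<^bsub>i+1\<^esub>\<close> that
  relabels \<open>x\<^sub>2, \<dots>, x\<^sub>n\<close> leaves the points \<open>a\<^sub>n, a\<^bsub>n-1\<^esub>, \<dots>\<close> of the shifted powers unchanged.
\<close>

section \<open>Branching of reverse tableaux\<close>

text \<open>Cutting at row \<open>n\<close> makes values from index \<open>n\<close> on irrelevant;
  interlacing shapes taken from a \<open>\<Pi>\<^sub>E\<close> are \<open>undefined\<close>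
  there.\<close>

definition first_rows :: "nat \<Rightarrow> (nat \<Rightarrow> nat) \<Rightarrow> (nat \<times> nat) set" where
  "first_rows n lam = {(i, j). i < n \<and> j < lam i}"

lemma first_rows_Sigma: "first_rows n lam = Sigma {..<n} (\<lambda>i. {..<lam i})"
  by (auto simp: first_rows_def)

lemma finite_first_rows: "finite (first_rows n lam)"
  by (simp add: first_rows_Sigma)

lemma finite_reverse_tableaux: "finite D \<Longrightarrow> finite (reverse_tableaux n D)"
  unfolding reverse_tableaux_def by (rule finite_subset[of _ "D \<rightarrow>\<^sub>E {1..n}"]) (auto intro: finite_PiE)

lemma reverse_tableaux_rangeD:
  "T \<in> reverse_tableaux n D \<Longrightarrow> b \<in> D \<Longrightarrow> 1 \<le> T b \<and> T b \<le> n"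
  by (auto simp: reverse_tableaux_def PiE_iff)

lemma reverse_tableaux_undefined:
  "T \<in> reverse_tableaux n D \<Longrightarrow> b \<notin> D \<Longrightarrow> T b = undefined"
  unfolding reverse_tableaux_def using PiE_arb by fast

lemma reverse_tableaux_rowD:
  "T \<in> reverse_tableaux n D \<Longrightarrow> (i, j) \<in> D \<Longrightarrow> (i, j') \<in> D \<Longrightarrow> j \<le> j' \<Longrightarrow> T (i, j') \<le> T (i, j)"
  by (cases "j = j'") (auto simp: reverse_tableaux_def)

lemma reverse_tableaux_columnD:
  "T \<in> reverse_tableaux n D \<Longrightarrow> (i, j) \<in> D \<Longrightarrow> (i', j) \<in> D \<Longrightarrow> i < i' \<Longrightarrow> T (i', j) < T (i, j)"
  unfolding reverse_tableaux_def by blast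

text \<open>Entries drop at each step down a column that starts at an entry of at most
  \<open>n\<close>. This forces the entries of row \<open>n\<close> to be 1 when the alphabet is
  \<open>{1..Suc n}\<close>, and excludes columns longer than the alphabet.\<close>

lemma reverse_tableau_add_row_le:
  assumes T: "T \<in> reverse_tableaux n D"
    and D: "\<forall>i'\<le>i. (i', j) \<in> D"
  shows "T (i, j) + i \<le> n"
  using D
proof (induction i)
  case 0
  then show ?case using reverse_tableaux_rangeD[OF T, of "(0, j)"] by simp
next
  case (Suc i)
  have "T (Suc i, j) < T (i, j)"
    using Suc.prems by (intro reverse_tableaux_columnD[OF T]) auto
  moreover have "T (i, j) + i \<le> n" using Suc by auto
  ultimately show ?case by simp
qed

text \<open>The weight depends on entry and box separately, so lowering all entries by one amounts
  to the shift \<open>\<lambda>k. w (Suc k)\<close>.\<close>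

definition tableau_sum :: "nat \<Rightarrow> (nat \<times> nat) set \<Rightarrow> (nat \<Rightarrow> nat \<times> nat \<Rightarrow> 'a) \<Rightarrow> 'a::comm_ring_1" where
  "tableau_sum n D w = (\<Sum>T\<in>reverse_tableaux n D. \<Prod>b\<in>D. w (T b) b)"

text \<open>Since \<open>lam (Suc i) \<le> rho i\<close>, a box with another box below it already
  lies in \<open>rho\<close>. So the new entries 1 sit only at column ends, and columns stay
  strict.\<close>

lemma reverse_tableaux_extend:
  assumes rho: "rho \<in> (\<Pi>\<^sub>E i\<in>{..<n}. {lam (Suc i)..lam i})"
    and anti: "antimono_on {..n} lam"
    and T: "T \<in> reverse_tableaux n (first_rows n rho)"
  shows "(\<lambda>b\<in>first_rows (Suc n) lam. if b \<in> first_rows n rho then Suc (T b) else 1)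
           \<in> reverse_tableaux (Suc n) (first_rows (Suc n) lam)"
    (is "?U \<in> reverse_tableaux _ ?D")
proof -
  note range = reverse_tableaux_rangeD[OF T]
  have rhoD: "lam (Suc i) \<le> rho i" if "i < n" for i using PiE_mem[OF rho, of i] that by simp
  have "?U \<in> ?D \<rightarrow>\<^sub>E {1..Suc n}"
    using range by auto
  moreover have "?U (i, j') \<le> ?U (i, j)" if "(i, j) \<in> ?D" "(i, j') \<in> ?D" "j < j'" for i j j'
  proof (cases "(i, j') \<in> first_rows n rho")
    case True
    moreover from True that have "(i, j) \<in> first_rows n rho" by (auto simp: first_rows_def)
    ultimately show ?thesis
      using that reverse_tableaux_rowD[OF T, of i j j'] by simp
  qed (use that in simp)
  moreover have "?U (i', j) < ?U (i, j)" if "(i, j) \<in> ?D" "(i', j) \<in> ?D" "i < i'" for i i' j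
  proof -
    have "i < n" "j < lam i'" "i' \<le> n" using that by (auto simp: first_rows_def)
    then have "(i, j) \<in> first_rows n rho"
      using rhoD[of i] monotone_onD[OF anti, of "Suc i" i'] that by (auto simp: first_rows_def)
    then show ?thesis
      using that range[of "(i, j)"] reverse_tableaux_columnD[OF T, of i j i'] by auto
  qed
  ultimately show ?thesis unfolding reverse_tableaux_def by blast
qed

text \<open>The interlacing shape \<open>\<rho>\<close> left after erasing the entries \<open>1\<close> of \<open>T\<close>.\<close>

definition rows_above_one :: "nat \<Rightarrow> (nat \<Rightarrow> nat) \<Rightarrow> (nat \<times> nat \<Rightarrow> nat) \<Rightarrow> nat \<Rightarrow> nat" where
  "rows_above_one n lam T = (\<lambda>i\<in>{..<n}. card {j. j < lam i \<and> 1 < T (i, j)})"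

text \<open>Rows decrease weakly, so the entries above 1 form an initial segment of each row, which
  its length determines.\<close>

lemma first_rows_rows_above_one:
  assumes T: "T \<in> reverse_tableaux (Suc n) (first_rows (Suc n) lam)"
    and anti: "antimono_on {..n} lam"
  shows "first_rows n (rows_above_one n lam T) = {b \<in> first_rows (Suc n) lam. 1 < T b}"
proof -
  have row: "{j. j < lam i \<and> 1 < T (i, j)} = {..<rows_above_one n lam T i}" if i: "i < n" for i
  proof -
    let ?S = "{j. j < lam i \<and> 1 < T (i, j)}"
    have down: "j \<in> ?S" if "j' \<in> ?S" "j \<le> j'" for j j'
      using that i reverse_tableaux_rowD[OF T, of i j j'] by (auto simp: first_rows_def)
    have "?S \<subseteq> {..<card ?S}"
    proof
      fix j assume j: "j \<in> ?S"
      have "{..j} \<subseteq> ?S" using down[OF j] by blast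
      then have "card {..j} \<le> card ?S" by (intro card_mono) auto
      then show "j \<in> {..<card ?S}" by simp
    qed
    then have "?S = {..<card ?S}" by (intro card_subset_eq) auto
    then show ?thesis using i by (simp add: rows_above_one_def)
  qed
  have last: "T (n, j) \<le> 1" if "j < lam n" for j
  proof -
    have "T (n, j) + n \<le> Suc n"
      by (rule reverse_tableau_add_row_le[OF T])
         (use that monotone_onD[OF anti, of _ n] in \<open>force simp: first_rows_def\<close>)
    then show ?thesis by simp
  qed
  have "(i, j) \<in> first_rows n (rows_above_one n lam T) \<longleftrightarrow>
      (i, j) \<in> first_rows (Suc n) lam \<and> 1 < T (i, j)" for i j
  proof (cases "i < n")
    case True
    then show ?thesis using equalityD1[OF row[OF True]] equalityD2[OF row[OF True]]
      by (auto simp: first_rows_def)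
  next
    case False
    then show ?thesis using last[of j] by (auto simp: first_rows_def less_Suc_eq)
  qed
  then show ?thesis by auto
qed

lemma rows_above_one_interlace:
  assumes T: "T \<in> reverse_tableaux (Suc n) (first_rows (Suc n) lam)"
    and anti: "antimono_on {..n} lam"
  shows "rows_above_one n lam T \<in> (\<Pi>\<^sub>E i\<in>{..<n}. {lam (Suc i)..lam i})"
proof -
  have "lam (Suc i) \<le> card {j. j < lam i \<and> 1 < T (i, j)}" (is "_ \<le> card ?S") if i: "i < n" for i
  proof -
    have "{..<lam (Suc i)} \<subseteq> ?S"
    proof
      fix j assume j: "j \<in> {..<lam (Suc i)}"
      then have D: "(i, j) \<in> first_rows (Suc n) lam" "(Suc i, j) \<in> first_rows (Suc n) lam"
        using i monotone_onD[OF anti, of i "Suc i"] by (auto simp: first_rows_def)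
      from reverse_tableaux_columnD[OF T D] reverse_tableaux_rangeD[OF T D(2)] D(1)
      show "j \<in> ?S" by (auto simp: first_rows_def)
    qed
    \<comment> \<open>The box below holds at least 1, so strictness forces more than 1 here.\<close>
    from card_mono[OF _ this] show ?thesis by simp
  qed
  moreover have "card {j. j < lam i \<and> 1 < T (i, j)} \<le> lam i" for i
    using card_mono[of "{..<lam i}" "{j. j < lam i \<and> 1 < T (i, j)}"] by auto
  ultimately show ?thesis by (auto simp: rows_above_one_def)
qed

lemma reverse_tableaux_strip:
  assumes T: "T \<in> reverse_tableaux (Suc n) (first_rows (Suc n) lam)"
    and anti: "antimono_on {..n} lam"
  shows "(\<lambda>b\<in>first_rows n (rows_above_one n lam T). T b - 1)
           \<in> reverse_tableaux n (first_rows n (rows_above_one n lam T))"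
    (is "?U \<in> reverse_tableaux _ ?E")
proof -
  note E = first_rows_rows_above_one[OF T anti]
  have mem: "b \<in> first_rows (Suc n) lam" "1 < T b" "T b \<le> Suc n" if "b \<in> ?E" for b
    using that reverse_tableaux_rangeD[OF T, of b] unfolding E by auto
  have "?U \<in> ?E \<rightarrow>\<^sub>E {1..n}"
    by (rule restrict_PiE_iff[THEN iffD2]) (use mem in fastforce)
  moreover have "?U (i, j') \<le> ?U (i, j)" if "(i, j) \<in> ?E" "(i, j') \<in> ?E" "j < j'" for i j j'
    using that reverse_tableaux_rowD[OF T mem(1)[OF that(1)] mem(1)[OF that(2)]] by simp
  moreover have "?U (i', j) < ?U (i, j)" if "(i, j) \<in> ?E" "(i', j) \<in> ?E" "i < i'" for i i' j
    using that reverse_tableaux_columnD[OF T mem(1)[OF that(1)] mem(1)[OF that(2)]]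
      mem(2)[OF that(2)] by simp
  ultimately show ?thesis unfolding reverse_tableaux_def by blast
qed

text \<open>Stripping and extending are mutually inverse: raised entries exceed 1, so they are told
  apart from the entries 1 in the added boxes.\<close>

lemma tableau_sum_branching:
  assumes anti: "antimono_on {..n} lam"
  shows "tableau_sum (Suc n) (first_rows (Suc n) lam) w =
    (\<Sum>rho\<in>(\<Pi>\<^sub>E i\<in>{..<n}. {lam (Suc i)..lam i}).
       tableau_sum n (first_rows n rho) (\<lambda>k. w (Suc k)) *
       (\<Prod>b\<in>first_rows (Suc n) lam - first_rows n rho. w 1 b))"
proof -
  let ?D = "first_rows (Suc n) lam"
  let ?H = "\<Pi>\<^sub>E i\<in>{..<n}. {lam (Suc i)..lam i}"
  let ?S = "Sigma ?H (\<lambda>rho. reverse_tableaux n (first_rows n rho))"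
  let ?ext = "\<lambda>(rho, T). \<lambda>b\<in>?D. if b \<in> first_rows n rho then Suc (T b) else 1"
  let ?strip = "\<lambda>T. (rows_above_one n lam T, \<lambda>b\<in>first_rows n (rows_above_one n lam T). T b - 1)"
  have rhoD: "lam (Suc i) \<le> rho i \<and> rho i \<le> lam i" if "rho \<in> ?H" "i < n" for rho i
    using that by (auto simp: PiE_iff)
  have sub: "first_rows n rho \<subseteq> ?D" if "rho \<in> ?H" for rho
    using rhoD[OF that] by (force simp: first_rows_def)
  have "tableau_sum (Suc n) ?D w = (\<Sum>(rho, T)\<in>?S.
      (\<Prod>b\<in>first_rows n rho. w (Suc (T b)) b) * (\<Prod>b\<in>?D - first_rows n rho. w 1 b))"
    unfolding tableau_sum_def
  proof (rule sum.reindex_bij_witness[of _ ?ext ?strip])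
    fix T assume T: "T \<in> reverse_tableaux (Suc n) ?D"
    note E = first_rows_rows_above_one[OF T anti]
    show "?ext (?strip T) = T"
    proof
      fix b
      show "?ext (?strip T) b = T b"
        using reverse_tableaux_rangeD[OF T, of b] reverse_tableaux_undefined[OF T, of b]
        by (auto simp: E)
    qed
    show "?strip T \<in> ?S"
      using rows_above_one_interlace[OF T anti] reverse_tableaux_strip[OF T anti] by simp
    let ?E = "first_rows n (rows_above_one n lam T)"
    have sub: "?E \<subseteq> ?D" by (auto simp: E)
    have "(\<Prod>b\<in>?D. w (T b) b) = (\<Prod>b\<in>?E. w (T b) b) * (\<Prod>b\<in>?D - ?E. w (T b) b)"
      by (subst prod.subset_diff[OF sub finite_first_rows]) (simp add: mult.commute)
    also have "(\<Prod>b\<in>?E. w (T b) b) = (\<Prod>b\<in>?E. w (Suc ((\<lambda>b\<in>?E. T b - 1) b)) b)"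
      by (rule prod.cong) (auto simp: E)
    also have "(\<Prod>b\<in>?D - ?E. w (T b) b) = (\<Prod>b\<in>?D - ?E. w 1 b)"
    proof (rule prod.cong)
      fix b assume "b \<in> ?D - ?E"
      then have "T b = 1" using reverse_tableaux_rangeD[OF T, of b] by (force simp: E)
      then show "w (T b) b = w 1 b" by simp
    qed simp
    finally show "(case ?strip T of (rho, T) \<Rightarrow>
        (\<Prod>b\<in>first_rows n rho. w (Suc (T b)) b) * (\<Prod>b\<in>?D - first_rows n rho. w 1 b))
        = (\<Prod>b\<in>?D. w (T b) b)" by simp
  next
    fix p assume p: "p \<in> ?S"
    obtain rho T where [simp]: "p = (rho, T)" by (cases p)
    from p have rho: "rho \<in> ?H" and T: "T \<in> reverse_tableaux n (first_rows n rho)" by auto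
    show "?ext p \<in> reverse_tableaux (Suc n) ?D"
      using reverse_tableaux_extend[OF rho anti T] by simp
    have "rows_above_one n lam (?ext p) i = rho i" for i
    proof (cases "i < n")
      case True
      have "1 < ?ext p (i, j) \<longleftrightarrow> j < rho i" if "j < lam i" for j
        using that True reverse_tableaux_rangeD[OF T, of "(i, j)"] by (auto simp: first_rows_def)
      then have "{j. j < lam i \<and> 1 < ?ext p (i, j)} = {..<rho i}"
        using rhoD[OF rho True] unfolding set_eq_iff mem_Collect_eq lessThan_iff
        by (meson less_le_trans)
      then show ?thesis using True by (simp add: rows_above_one_def)
    next
      case False
      \<comment> \<open>Outside \<open>{..<n}\<close> both functions take the default value
        \<open>undefined\<close>.\<close>
      then show ?thesis using PiE_arb[OF rho] by (simp add: rows_above_one_def)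
    qed
    then have rows: "rows_above_one n lam (?ext p) = rho" by blast
    have res: "(\<lambda>b\<in>first_rows n rho. ?ext p b - 1) = T"
    proof
      fix b
      show "(\<lambda>b\<in>first_rows n rho. ?ext p b - 1) b = T b"
        using sub[OF rho] reverse_tableaux_undefined[OF T, of b] by auto
    qed
    then show "?strip (?ext p) = p" unfolding rows res by simp
  qed
  also have "\<dots> = (\<Sum>rho\<in>?H. \<Sum>T\<in>reverse_tableaux n (first_rows n rho).
      (\<Prod>b\<in>first_rows n rho. w (Suc (T b)) b) * (\<Prod>b\<in>?D - first_rows n rho. w 1 b))"
    by (rule sum.Sigma[symmetric])
       (auto intro!: finite_PiE finite_reverse_tableaux finite_first_rows)
  finally show ?thesis
    by (simp add: tableau_sum_def sum_distrib_right)
qed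

section \<open>Branching of the bialternant\<close>

text \<open>The points \<open>b k = a (n - k)\<close> give the shifted power; with arbitrary points
  the recursion does not depend on how they come from \<open>a\<close>.\<close>

definition falling_product :: "(nat \<Rightarrow> 'a::comm_ring_1) \<Rightarrow> 'a \<Rightarrow> nat \<Rightarrow> 'a" where
  "falling_product b x r = (\<Prod>k<r. x - b k)"

text \<open>The difference telescopes: the term for \<open>r\<close> replaces the factor
  \<open>y - b r\<close> by \<open>z - b r\<close>, which contributes \<open>y - z\<close>.\<close>

lemma falling_product_diff:
  assumes "m \<le> l"
  shows "falling_product b y l - (\<Prod>k=m..<l. z - b k) * falling_product b y m =
    (y - z) * (\<Sum>r=m..<l. (\<Prod>k=Suc r..<l. z - b k) * falling_product b y r)"
  using assms
proof (induction l rule: dec_induct)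
  case base
  then show ?case by simp
next
  case (step l)
  let ?F = "falling_product b y" and ?P = "\<lambda>m l. \<Prod>k=m..<l. z - b k"
  have F: "?F (Suc l) = (y - b l) * ?F l" by (simp add: falling_product_def mult.commute)
  have P: "?P m (Suc l) = (z - b l) * ?P m l" if "m \<le> l" for m
    using that by (simp add: mult.commute)
  have "(\<Sum>r=m..<Suc l. ?P (Suc r) (Suc l) * ?F r) =
      (\<Sum>r=m..<l. ?P (Suc r) (Suc l) * ?F r) + ?F l"
    using step.hyps by simp
  also have "(\<Sum>r=m..<l. ?P (Suc r) (Suc l) * ?F r) = (z - b l) * (\<Sum>r=m..<l. ?P (Suc r) l * ?F r)"
    unfolding sum_distrib_left by (rule sum.cong) (auto simp: P mult.assoc)
  finally have sum: "(\<Sum>r=m..<Suc l. ?P (Suc r) (Suc l) * ?F r) =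
      (z - b l) * (\<Sum>r=m..<l. ?P (Suc r) l * ?F r) + ?F l" .
  have "(y - z) * (c * s + f) = c * ((y - z) * s) + (y - z) * f" for c s f :: 'a
    by (simp add: algebra_simps)
  then have "(y - z) * (\<Sum>r=m..<Suc l. ?P (Suc r) (Suc l) * ?F r) =
      (z - b l) * ((y - z) * (\<Sum>r=m..<l. ?P (Suc r) l * ?F r)) + (y - z) * ?F l"
    by (simp only: sum)
  also have "\<dots> = (z - b l) * (?F l - ?P m l * ?F m) + (y - z) * ?F l"
    by (simp only: step.IH)
  also have "\<dots> = ?F (Suc l) - ?P m (Suc l) * ?F m"
    using step.hyps by (simp add: F P algebra_simps)
  finally show ?case by simp
qed

lemma det_factor_rows:
  fixes d :: "nat \<Rightarrow> 'a::comm_ring_1"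
  shows "det (mat n n (\<lambda>(i, j). d i * g i j)) = (\<Prod>i<n. d i) * det (mat n n (\<lambda>(i, j). g i j))"
proof -
  have "(\<Prod>i = 0..<n. mat n n (\<lambda>(i, j). d i * g i j) $$ (i, p i)) =
      (\<Prod>i<n. d i) * (\<Prod>i = 0..<n. mat n n (\<lambda>(i, j). g i j) $$ (i, p i))"
    if "p permutes {0..<n}" for p
    using permutes_in_image[OF that]
    by (simp add: prod.distrib[symmetric] lessThan_atLeast0)
  then show ?thesis
    by (subst (1 2) det_def'[of _ n]) (auto simp: sum_distrib_left mult.left_commute intro!: sum.cong)
qed

text \<open>Multilinearity: every column picks its summand independently. For intervals
  \<open>{lam (Suc j)..lam j}\<close> the choices are exactly the interlacing shapes.\<close>

lemma det_sum_columns: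
  fixes c :: "nat \<Rightarrow> 'b \<Rightarrow> 'a::comm_ring_1"
  assumes fin: "\<And>j. j < n \<Longrightarrow> finite (S j)"
  shows "det (mat n n (\<lambda>(i, j). \<Sum>r\<in>S j. c j r * g i j r)) =
    (\<Sum>f\<in>(\<Pi>\<^sub>E j\<in>{..<n}. S j). (\<Prod>j<n. c j (f j)) * det (mat n n (\<lambda>(i, j). g i j (f j))))"
proof -
  let ?P = "{p. p permutes {0..<n}}"
  have col: "det (mat n n (\<lambda>(i, j). h i j)) = (\<Sum>p\<in>?P. signof p * (\<Prod>j<n. h (p j) j))"
    for h :: "nat \<Rightarrow> nat \<Rightarrow> 'a"
  proof -
    have "(\<Prod>j<n. mat n n (\<lambda>(i, j). h i j) $$ (p j, j)) = (\<Prod>j<n. h (p j) j)"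
      if "p permutes {0..<n}" for p
      using permutes_in_image[OF that] by (intro prod.cong) auto
    then show ?thesis by (subst det_col[of _ n]) (auto intro!: sum.cong)
  qed
  have "det (mat n n (\<lambda>(i, j). \<Sum>r\<in>S j. c j r * g i j r)) =
      (\<Sum>p\<in>?P. signof p * (\<Prod>j<n. \<Sum>r\<in>S j. c j r * g (p j) j r))"
    by (rule col)
  also have "\<dots> = (\<Sum>p\<in>?P. \<Sum>f\<in>(\<Pi>\<^sub>E j\<in>{..<n}. S j).
      (\<Prod>j<n. c j (f j)) * (signof p * (\<Prod>j<n. g (p j) j (f j))))"
  proof (rule sum.cong)
    fix p
    have "(\<Prod>j<n. \<Sum>r\<in>S j. c j r * g (p j) j r) =
        (\<Sum>f\<in>(\<Pi>\<^sub>E j\<in>{..<n}. S j). \<Prod>j<n. c j (f j) * g (p j) j (f j))"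
      by (rule prod_sum_PiE) (use fin in auto)
    then show "signof p * (\<Prod>j<n. \<Sum>r\<in>S j. c j r * g (p j) j r) =
        (\<Sum>f\<in>(\<Pi>\<^sub>E j\<in>{..<n}. S j). (\<Prod>j<n. c j (f j)) * (signof p * (\<Prod>j<n. g (p j) j (f j))))"
      by (simp add: sum_distrib_left prod.distrib mult.left_commute)
  qed simp
  also have "\<dots> = (\<Sum>f\<in>(\<Pi>\<^sub>E j\<in>{..<n}. S j).
      (\<Prod>j<n. c j (f j)) * (\<Sum>p\<in>?P. signof p * (\<Prod>j<n. g (p j) j (f j))))"
    by (subst sum.swap) (simp add: sum_distrib_left)
  finally show ?thesis by (simp only: col)
qed

text \<open>All columns change at once, each using the old next column. This is right multiplication
  by a lower unitriangular matrix.\<close>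

lemma det_subtract_next_column:
  fixes g :: "nat \<Rightarrow> nat \<Rightarrow> 'a::comm_ring_1"
  shows "det (mat (Suc n) (Suc n) (\<lambda>(i, j). if j < n then g i j - R j * g i (Suc j) else g i j)) =
    det (mat (Suc n) (Suc n) (\<lambda>(i, j). g i j))"
proof -
  let ?N = "Suc n"
  define U :: "'a mat" where
    "U = mat ?N ?N (\<lambda>(k, j). if k = j then 1 else if k = Suc j then - R j else 0)"
  let ?A = "mat ?N ?N (\<lambda>(i, j). g i j)"
  have "det U = prod_list (diag_mat U)"
    by (rule det_lower_triangular[of ?N]) (auto simp: U_def)
  also have "\<dots> = 1"
    unfolding prod_list_diag_prod by (rule prod.neutral) (auto simp: U_def)
  finally have U: "det U = 1" .
  have "?A * U = mat ?N ?N (\<lambda>(i, j). if j < n then g i j - R j * g i (Suc j) else g i j)"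
  proof (rule eq_matI, goal_cases)
    case (1 i j)
    then have ij: "i < ?N" "j < ?N" by auto
    \<comment> \<open>For \<open>j = n\<close> the index \<open>Suc j\<close> is out of range, so
      the last column is kept.\<close>
    have "(?A * U) $$ (i, j) =
        (\<Sum>k<?N. (if k = j then g i k else 0) + (if k = Suc j then - R j * g i k else 0))"
      using ij by (auto simp: scalar_prod_def U_def lessThan_atLeast0 intro!: sum.cong)
    also have "\<dots> = (if j < n then g i j - R j * g i (Suc j) else g i j)"
      using ij by (simp add: sum.distrib del: sum.lessThan_Suc)
    finally show ?case using ij by simp
  qed (auto simp: U_def)
  then show ?thesis
    using det_mult[of ?A ?N U] U by (simp add: U_def)
qed

lemma det_falling_product_rec:
  fixes x b :: "nat \<Rightarrow> 'a::comm_ring_1"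
  assumes anti: "antimono_on {..n} lam"
  shows "det (mat (Suc n) (Suc n) (\<lambda>(i, j). falling_product b (x i) (lam j + (n - j)))) =
    falling_product b (x 0) (lam n) * (\<Prod>i<n. x 0 - x (Suc i)) *
    (\<Sum>rho\<in>(\<Pi>\<^sub>E i\<in>{..<n}. {lam (Suc i)..lam i}).
       (\<Prod>j<n. \<Prod>k=Suc (rho j + (n - Suc j))..<lam j + (n - j). x 0 - b k) *
       det (mat n n (\<lambda>(i, j). falling_product b (x (Suc i)) (rho j + (n - Suc j)))))"
proof -
  let ?F = "falling_product b" and ?L = "\<lambda>j. lam j + (n - j)"
  let ?P = "\<lambda>m l. \<Prod>k=m..<l. x 0 - b k"
  let ?g = "\<lambda>i j. ?F (x i) (?L j)"
  let ?B = "mat (Suc n) (Suc n)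
    (\<lambda>(i, j). if j < n then ?g i j - ?P (?L (Suc j)) (?L j) * ?g i (Suc j) else ?g i j)"
  let ?M = "\<lambda>i j. \<Sum>r\<in>{lam (Suc j)..lam j}.
      ?P (Suc (r + (n - Suc j))) (?L j) * ?F (x (Suc i)) (r + (n - Suc j))"
  \<comment> \<open>At \<open>y = x 0\<close> this is zero and clears the first row up to its last
    entry; at the other points it extracts the factor \<open>y - x 0\<close>.\<close>
  have entry: "?F y (?L j) - ?P (?L (Suc j)) (?L j) * ?F y (?L (Suc j)) =
      (y - x 0) * (\<Sum>r\<in>{lam (Suc j)..lam j}.
        ?P (Suc (r + (n - Suc j))) (?L j) * ?F y (r + (n - Suc j)))" if "j < n" for y j
  proof -
    \<comment> \<open>After a shift by \<open>n - Suc j\<close>, this \<open>Suc\<close> turns the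
      half-open range of exponents into the closed interlacing interval.\<close>
    have L: "?L j = Suc (lam j) + (n - Suc j)" using that by simp
    have "(\<Sum>r\<in>{?L (Suc j)..<?L j}. ?P (Suc r) (?L j) * ?F y r) =
        (\<Sum>r\<in>{lam (Suc j)..<Suc (lam j)}.
          ?P (Suc (r + (n - Suc j))) (?L j) * ?F y (r + (n - Suc j)))"
      unfolding L by (rule sum.shift_bounds_nat_ivl)
    moreover have "?L (Suc j) \<le> ?L j" using monotone_onD[OF anti, of j "Suc j"] that by simp
    ultimately show ?thesis
      by (simp only: falling_product_diff atLeastLessThanSuc_atLeastAtMost)
  qed
  have "det (mat (Suc n) (Suc n) (\<lambda>(i, j). ?g i j)) = det ?B"
    by (rule det_subtract_next_column[symmetric])
  also have "\<dots> = (\<Sum>j<Suc n. ?B $$ (0, j) * cofactor ?B 0 j)"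
    by (rule laplace_expansion_row) auto
  also have "\<dots> = ?F (x 0) (lam n) * cofactor ?B 0 n"
    using entry[of _ "x 0"] by simp
  also have "cofactor ?B 0 n = (- 1) ^ n * det (mat n n (\<lambda>(i, j). (x (Suc i) - x 0) * ?M i j))"
  proof -
    have "mat_delete ?B 0 n = mat n n (\<lambda>(i, j). (x (Suc i) - x 0) * ?M i j)"
    proof (rule eq_matI, goal_cases)
      case (1 i j)
      then have ij: "i < n" "j < n" by auto
      then have "mat_delete ?B 0 n $$ (i, j) =
          ?g (Suc i) j - ?P (?L (Suc j)) (?L j) * ?g (Suc i) (Suc j)"
        by (simp add: mat_delete_def)
      also have "\<dots> = (x (Suc i) - x 0) * ?M i j"
        by (rule entry[OF ij(2)])
      finally show ?case using ij by simp
    qed (auto simp: mat_delete_def)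
    then show ?thesis by (simp add: cofactor_def)
  qed
  also have "det (mat n n (\<lambda>(i, j). (x (Suc i) - x 0) * ?M i j)) =
      (\<Prod>i<n. x (Suc i) - x 0) * det (mat n n (\<lambda>(i, j). ?M i j))"
    by (rule det_factor_rows)
  also have "(\<Prod>i<n. x (Suc i) - x 0) = (- 1) ^ n * (\<Prod>i<n. x 0 - x (Suc i))"
    by (induction n) (simp_all add: algebra_simps)
  also have "det (mat n n (\<lambda>(i, j). ?M i j)) =
    (\<Sum>rho\<in>(\<Pi>\<^sub>E i\<in>{..<n}. {lam (Suc i)..lam i}).
       (\<Prod>j<n. \<Prod>k=Suc (rho j + (n - Suc j))..<lam j + (n - j). x 0 - b k) *
       det (mat n n (\<lambda>(i, j). falling_product b (x (Suc i)) (rho j + (n - Suc j)))))"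
    by (rule det_sum_columns) simp
  \<comment> \<open>The cofactor sign cancels the sign from reversing \<open>n\<close>
    differences.\<close>
  also have "?F (x 0) (lam n) * ((- 1) ^ n * ((- 1) ^ n * p * q)) = ?F (x 0) (lam n) * p * q" for p q
  proof -
    have "((- 1) ^ n * (- 1) ^ n :: 'a) = 1" by (simp flip: power_mult_distrib)
    then show ?thesis by (metis mult.assoc mult_1)
  qed
  finally show ?thesis .
qed

section \<open>Matching the two branching rules\<close>

text \<open>Putting \<open>k = j + (n - i)\<close> turns the content \<open>j - i\<close> into
  \<open>k - n\<close>, so the weight of the strip becomes the coefficient in the determinant
  recursion. Row \<open>n\<close> lies wholly in the strip and gives the separate factor.\<close>

lemma prod_strip:
  fixes h :: "int \<Rightarrow> 'a::comm_monoid_mult"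
  assumes rho: "\<forall>i<n. rho i \<le> lam i"
  shows "(\<Prod>b\<in>first_rows (Suc n) lam - first_rows n rho. h (content b)) =
    (\<Prod>i<n. \<Prod>k=Suc (rho i + (n - Suc i))..<lam i + (n - i). h (int k - int n)) *
    (\<Prod>k<lam n. h (int k - int n))"
proof -
  have "first_rows (Suc n) lam - first_rows n rho =
      Sigma {..<Suc n} (\<lambda>i. {(if i < n then rho i else 0)..<lam i})"
    by (auto simp: first_rows_def less_Suc_eq split: if_splits)
  then have "(\<Prod>b\<in>first_rows (Suc n) lam - first_rows n rho. h (content b)) =
      (\<Prod>i<Suc n. \<Prod>j=(if i < n then rho i else 0)..<lam i. h (content (i, j)))"
    by (subst prod.Sigma) (auto simp: case_prod_beta')
  also have "\<dots> = (\<Prod>i<n. \<Prod>j=rho i..<lam i. h (content (i, j))) * (\<Prod>j<lam n. h (content (n, j)))"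
    by (simp add: lessThan_atLeast0)
  also have "(\<Prod>i<n. \<Prod>j=rho i..<lam i. h (content (i, j))) =
      (\<Prod>i<n. \<Prod>k=Suc (rho i + (n - Suc i))..<lam i + (n - i). h (int k - int n))"
  proof (rule prod.cong)
    fix i assume "i \<in> {..<n}"
    then have i: "Suc (rho i + (n - Suc i)) = rho i + (n - i)" "i < n" by auto
    show "(\<Prod>j=rho i..<lam i. h (content (i, j))) =
        (\<Prod>k=Suc (rho i + (n - Suc i))..<lam i + (n - i). h (int k - int n))"
      unfolding i(1) prod.shift_bounds_nat_ivl using i(2)
      by (intro prod.cong) (auto simp: content_def of_nat_diff)
  qed simp
  finally show ?thesis by (simp add: content_def)
qed

text \<open>Both sides obey the same recursion once the factors involving \<open>x 1\<close> are
  split off the Vandermonde product. Multiplying by that product avoids division in a general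
  ring.\<close>

lemma tableau_sum_eq_bialternant:
  fixes x :: "nat \<Rightarrow> 'a::comm_ring_1" and a :: "int \<Rightarrow> 'a"
  assumes "antimono_on {..<n} lam"
  shows "tableau_sum n (first_rows n lam) (\<lambda>k b. x k - a (int k - content b)) *
      (\<Prod>i<n. \<Prod>j=Suc i..<n. x (Suc i) - x (Suc j)) =
    det (mat n n (\<lambda>(i, j). falling_product (\<lambda>k. a (int n - int k)) (x (Suc i)) (lam j + (n - Suc j))))"
  using assms
proof (induction n arbitrary: lam x a)
  case 0
  have "reverse_tableaux 0 {} = {\<lambda>_. undefined}"
    by (auto simp: reverse_tableaux_def)
  then show ?case by (simp add: tableau_sum_def first_rows_def det_dim_zero)
next
  case (Suc n)
  let ?H = "\<Pi>\<^sub>E i\<in>{..<n}. {lam (Suc i)..lam i}"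
  let ?b = "\<lambda>k. a (int (Suc n) - int k)"
  let ?V = "\<Prod>i<n. \<Prod>j=Suc i..<n. x (Suc (Suc i)) - x (Suc (Suc j))"
  let ?t = "\<lambda>rho. tableau_sum n (first_rows n rho) (\<lambda>k b. x (Suc k) - a (int (Suc k) - content b))"
  let ?c = "\<lambda>rho. \<Prod>i<n. \<Prod>k=Suc (rho i + (n - Suc i))..<lam i + (n - i). x 1 - ?b k"
  let ?d = "\<lambda>rho. det (mat n n (\<lambda>(i, j). falling_product ?b (x (Suc (Suc i))) (rho j + (n - Suc j))))"
  have anti: "antimono_on {..n} lam"
    using Suc.prems by (simp only: lessThan_Suc_atMost)
  have IH: "?t rho * ?V = ?d rho" if "rho \<in> ?H" for rho
  proof -
    \<comment> \<open>Interlacing gives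
      \<open>rho j \<le> lam j \<le> lam (Suc i) \<le> rho i\<close> for
      \<open>i < j\<close>.\<close>
    have "rho j \<le> rho i" if "i \<le> j" "j < n" for i j
    proof (cases "i = j")
      case False
      have "rho j \<le> lam j" "lam (Suc i) \<le> rho i"
        using PiE_mem[OF \<open>rho \<in> ?H\<close>, of j] PiE_mem[OF \<open>rho \<in> ?H\<close>, of i] that by auto
      moreover have "lam j \<le> lam (Suc i)" using monotone_onD[OF anti, of "Suc i" j] False that by simp
      ultimately show ?thesis by simp
    qed simp
    then have "antimono_on {..<n} rho" by (auto intro!: monotone_onI)
    \<comment> \<open>Shifting \<open>x\<close> and \<open>a\<close> together keeps the points:
      \<open>(n - k) + 1 = Suc n - k\<close>.\<close>
    from Suc.IH[of rho "\<lambda>k. x (Suc k)" "\<lambda>m. a (m + 1)", OF this]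
    show ?thesis by (simp add: algebra_simps)
  qed
  have strip: "(\<Prod>b\<in>first_rows (Suc n) lam - first_rows n rho. x 1 - a (1 - content b)) =
      ?c rho * falling_product ?b (x 1) (lam n)" if "rho \<in> ?H" for rho
  proof -
    have "\<forall>i<n. rho i \<le> lam i" using PiE_mem[OF that] by auto
    \<comment> \<open>Entry 1 in a box of content \<open>k - n\<close> has parameter index
      \<open>1 - (k - n) = Suc n - k\<close>, that of \<open>?b k\<close>.\<close>
    from prod_strip[of n rho lam "\<lambda>c. x 1 - a (1 - c)", OF this]
    show ?thesis by (simp add: falling_product_def algebra_simps)
  qed
  have V: "(\<Prod>i<Suc n. \<Prod>j=Suc i..<Suc n. x (Suc i) - x (Suc j)) =
      (\<Prod>i<n. x 1 - x (Suc (Suc i))) * ?V"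
    by (subst prod.lessThan_Suc_shift, subst (1 2) prod.shift_bounds_Suc_ivl) (simp add: lessThan_atLeast0)
  have regroup: "(\<Sum>rho\<in>H. t rho * (c rho * f)) * (p * v) = f * p * (\<Sum>rho\<in>H. c rho * (t rho * v))"
    for H and t c :: "(nat \<Rightarrow> nat) \<Rightarrow> 'a" and f p v
    by (simp add: sum_distrib_left sum_distrib_right ac_simps)
  have "tableau_sum (Suc n) (first_rows (Suc n) lam) (\<lambda>k b. x k - a (int k - content b)) =
      (\<Sum>rho\<in>?H. ?t rho * (?c rho * falling_product ?b (x 1) (lam n)))"
    unfolding tableau_sum_branching[OF anti] by (rule sum.cong) (use strip in simp_all)
  then have "tableau_sum (Suc n) (first_rows (Suc n) lam) (\<lambda>k b. x k - a (int k - content b)) *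
        (\<Prod>i<Suc n. \<Prod>j=Suc i..<Suc n. x (Suc i) - x (Suc j)) =
      (\<Sum>rho\<in>?H. ?t rho * (?c rho * falling_product ?b (x 1) (lam n))) *
        ((\<Prod>i<n. x 1 - x (Suc (Suc i))) * ?V)"
    by (simp only: V)
  also have "\<dots> = falling_product ?b (x 1) (lam n) * (\<Prod>i<n. x 1 - x (Suc (Suc i))) *
      (\<Sum>rho\<in>?H. ?c rho * (?t rho * ?V))"
    by (rule regroup)
  also have "(\<Sum>rho\<in>?H. ?c rho * (?t rho * ?V)) = (\<Sum>rho\<in>?H. ?c rho * ?d rho)"
    by (rule sum.cong) (simp_all only: IH)
  also have "falling_product ?b (x 1) (lam n) * (\<Prod>i<n. x 1 - x (Suc (Suc i))) *
        (\<Sum>rho\<in>?H. ?c rho * ?d rho) =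
      det (mat (Suc n) (Suc n) (\<lambda>(i, j). falling_product ?b (x (Suc i)) (lam j + (n - j))))"
    using det_falling_product_rec[OF anti, of ?b "\<lambda>i. x (Suc i)"] by simp
  finally show ?case by simp
qed

section \<open>Evaluation of the supersymmetric Schur function\<close>

text \<open>The support of an antimonotone sequence is an initial segment.\<close>

lemma is_partition_zero_iff:
  assumes "is_partition nu"
  shows "part_length nu \<le> n \<longleftrightarrow> nu n = 0"
proof
  have fin: "finite {i. nu i \<noteq> 0}" and anti: "antimono nu"
    using assms by (auto simp: is_partition_def)
  assume "part_length nu \<le> n"
  show "nu n = 0"
  proof (rule ccontr)
    assume "nu n \<noteq> 0"
    then have "{..n} \<subseteq> {i. nu i \<noteq> 0}" using antimonoD[OF anti, of _ n] by fastforce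
    from card_mono[OF fin this] \<open>part_length nu \<le> n\<close> show False by (simp add: part_length_def)
  qed
next
  have anti: "antimono nu" using assms by (simp add: is_partition_def)
  assume "nu n = 0"
  then have "{i. nu i \<noteq> 0} \<subseteq> {..<n}"
    using antimonoD[OF anti, of n] by (metis (mono_tags) lessThan_iff linorder_not_le mem_Collect_eq le_zero_eq subsetI)
  from card_mono[OF _ this] show "part_length nu \<le> n" by (simp add: part_length_def)
qed

lemma diagram_eq_first_rows:
  assumes "is_partition nu" "nu n = 0"
  shows "diagram nu = first_rows n nu"
proof -
  have "antimono nu" using assms(1) by (simp add: is_partition_def)
  then have "i < n" if "j < nu i" for i j
    using antimonoD[of nu n i] assms(2) that by (metis linorder_not_le le_zero_eq not_less_zero)
  then show ?thesis by (auto simp: diagram_def first_rows_def)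
qed

lemma finite_diagram:
  assumes "is_partition nu"
  shows "finite (diagram nu)"
  using diagram_eq_first_rows[OF assms, of "part_length nu"]
    is_partition_zero_iff[OF assms, of "part_length nu"]
  by (simp add: finite_first_rows)

lemma inj_diagram: "inj diagram"
proof (rule injI)
  fix lam mu assume *: "diagram lam = diagram mu"
  have "{..<lam i} = {..<mu i}" for i
    using * by (auto simp: diagram_def set_eq_iff)
  then show "lam = mu" by auto
qed

section \<open>Effect of the substitution on the tableau sums\<close>

lemma psubst_prod: "psubst f (\<Prod>i\<in>I. p i) = (\<Prod>i\<in>I. psubst f (p i))"
  by (induction I rule: infinite_finite_induct) (simp_all add: psubst_mult)

text \<open>The box \<open>(0, 0)\<close> has content \<open>0\<close>, so its factor \<open>y\<^sub>k + a\<^sub>k\<close> is killed by \<open>y\<^sub>k \<mapsto> -a\<^sub>k\<close>.\<close>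

lemma eval_schur_y_eq_0:
  assumes "(0, 0) \<in> D" "finite D"
  shows "eval_y_minus_a (schur_y D) n = 0"
  unfolding eval_y_minus_a_def schur_y_def psubst_sum psubst_prod
  by (intro sum.neutral ballI prod_zero bexI[OF _ assms(1)] assms(2))
     (simp add: psubst_add content_def)

lemma eval_schur_tilde_x:
  "eval_y_minus_a (schur_tilde_x D) n =
    tableau_sum n D (\<lambda>k b. pvar k - pconst (avar (int k - content b)))"
  unfolding eval_y_minus_a_def schur_tilde_x_def psubst_sum psubst_prod tableau_sum_def
  by (simp add: psubst_diff)

lemma eval_super_schur:
  assumes nu: "is_partition nu"
  shows "eval_y_minus_a (super_schur nu) n =
    tableau_sum n (diagram nu) (\<lambda>k b. pvar k - pconst (avar (int k - content b)))"
proof -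
  let ?R = "{rho. is_partition rho \<and> diagram (\<lambda>_. 0) \<subseteq> diagram rho \<and> diagram rho \<subseteq> diagram nu}"
  let ?e = "\<lambda>rho. eval_y_minus_a (schur_tilde_x (diagram nu - diagram rho)) n *
    eval_y_minus_a (schur_y ((diagram rho)\<inverse> - (diagram (\<lambda>_. 0))\<inverse>)) n"
  \<comment> \<open>Finiteness must be shown, as a sum over an infinite set is 0 by
    convention.\<close>
  have "diagram ` ?R \<subseteq> Pow (diagram nu)" by auto
  then have fin: "finite ?R"
    using finite_imageD[of diagram ?R] finite_diagram[OF nu] inj_diagram
    by (meson finite_Pow_iff finite_subset inj_on_subset subset_UNIV)
  have empty: "diagram (\<lambda>_. 0) = {}" by (simp add: diagram_def)
  have zero: "(\<lambda>_. 0) \<in> ?R" by (simp add: empty is_partition_def monotone_def)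
  have vanish: "?e rho = 0" if "rho \<in> ?R - {\<lambda>_. 0}" for rho
  proof -
    \<comment> \<open>A nonempty diagram contains the corner box, which conjugation fixes.\<close>
    have "diagram rho \<noteq> {}" using that inj_diagram empty by (auto dest: injD)
    then obtain i where "rho i \<noteq> 0" by (force simp: diagram_def)
    moreover have "rho i \<le> rho 0" using that by (auto simp: is_partition_def antimono_def)
    ultimately have "(0, 0) \<in> (diagram rho)\<inverse>" by (auto simp: diagram_def)
    moreover have "finite ((diagram rho)\<inverse>)" using finite_diagram that by auto
    ultimately show ?thesis by (simp add: empty eval_schur_y_eq_0)
  qed
  have "eval_y_minus_a (super_schur nu) n = (\<Sum>rho\<in>?R. ?e rho)"
    by (simp only: eval_y_minus_a_def super_schur_def super_schur_skew_def psubst_sum psubst_mult)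
  also have "\<dots> = (\<Sum>rho\<in>{\<lambda>_. 0}. ?e rho)"
    by (rule sum.mono_neutral_right) (use fin zero vanish in auto)
  also have "\<dots> = eval_y_minus_a (schur_tilde_x (diagram nu)) n"
  proof -
    \<comment> \<open>The empty shape has one tableau, so its sum is 1 and not 0.\<close>
    have "semistandard_tableaux n {} = {\<lambda>_. undefined}"
      by (auto simp: semistandard_tableaux_def)
    then have "schur_y {} n = 1" by (simp add: schur_y_def)
    then show ?thesis by (simp add: empty eval_y_minus_a_def)
  qed
  finally show ?thesis by (simp add: eval_schur_tilde_x)
qed

section \<open>Exact division by the Vandermonde product\<close>

lemma vandermonde_eq:
  "vandermonde n = (\<Prod>i<n. \<Prod>j=Suc i..<n. pvar (Suc i) - pvar (Suc j))"
proof -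
  have "(\<Prod>i<n. \<Prod>j=Suc i..<n. pvar (Suc i) - pvar (Suc j) :: (nat, Qa) mpol) =
      (\<Prod>(i, j)\<in>Sigma {..<n} (\<lambda>i. {Suc i..<n}). pvar (Suc i) - pvar (Suc j))"
    by (rule prod.Sigma) auto
  also have "\<dots> = vandermonde n"
    unfolding vandermonde_def
    by (rule prod.reindex_bij_witness[of _ "\<lambda>(i, j). (i - 1, j - 1)" "\<lambda>(i, j). (Suc i, Suc j)"]) auto
  finally show ?thesis ..
qed

text \<open>Polynomials have no zero divisors, so it suffices that distinct variables differ. This
  makes the quotient chosen by \<open>THE\<close> unique.\<close>

lemma vandermonde_nonzero: "vandermonde n \<noteq> 0"
proof -
  have "pvar i \<noteq> (pvar j :: (nat, Qa) mpol)" if "i < j" for i j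
  proof
    assume "pvar i = (pvar j :: (nat, Qa) mpol)"
    then have "pvars (pvar i :: (nat, Qa) mpol) = pvars (pvar j :: (nat, Qa) mpol)" by simp
    then show False using that by (simp add: pvars_def pvar_def)
  qed
  then show ?thesis unfolding vandermonde_eq by auto
qed

theorem proposition2p5:
  fixes nu :: "nat \<Rightarrow> nat"
  assumes "is_partition nu"
  shows "eval_y_minus_a (super_schur nu) = double_schur nu"
proof
  fix n
  let ?s = "tableau_sum n (diagram nu) (\<lambda>k b. pvar k - pconst (avar (int k - content b)))"
  have anti: "antimono nu" using assms by (simp add: is_partition_def)
  have "?s = double_schur nu n"
  proof (cases "nu n = 0")
    case True
    let ?A = "mat n n (\<lambda>(i, j). shifted_power n (i + 1) (nu j + n - (j + 1)))"
    have "?s * vandermonde n = det (mat n n (\<lambda>(i, j).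
        falling_product (\<lambda>k. pconst (avar (int n - int k))) (pvar (Suc i)) (nu j + (n - Suc j))))"
      using tableau_sum_eq_bialternant[OF monotone_on_subset[OF anti], of n pvar "\<lambda>m. pconst (avar m)"]
      by (simp add: vandermonde_eq diagram_eq_first_rows[OF assms True])
    also have "\<dots> = det ?A"
      by (intro arg_cong[of _ _ det] eq_matI) (auto simp: shifted_power_def falling_product_def)
    finally have s: "?s * vandermonde n = det ?A" .
    have "(THE q. q * vandermonde n = det ?A) = ?s"
    proof (rule the_equality)
      fix q assume "q * vandermonde n = det ?A"
      with s have "q * vandermonde n = ?s * vandermonde n" by simp
      then show "q = ?s" using vandermonde_nonzero by simp
    qed (rule s)
    then show ?thesis
      using True by (simp add: double_schur_def is_partition_zero_iff[OF assms])
  next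
    case False
    \<comment> \<open>The first column has more than \<open>n\<close> boxes, too many for strictly
      decreasing entries from \<open>{1..n}\<close>; both sides are 0.\<close>
    have "reverse_tableaux n (diagram nu) = {}"
    proof (rule ccontr)
      assume "reverse_tableaux n (diagram nu) \<noteq> {}"
      then obtain T where T: "T \<in> reverse_tableaux n (diagram nu)" by auto
      have D: "\<forall>i\<le>n. (i, 0) \<in> diagram nu"
        using antimonoD[OF anti, of _ n] False by (force simp: diagram_def)
      then have "1 \<le> T (n, 0)" using reverse_tableaux_rangeD[OF T] by blast
      with reverse_tableau_add_row_le[OF T D] show False by simp
    qed
    then show ?thesis
      using False by (simp add: tableau_sum_def double_schur_def is_partition_zero_iff[OF assms])
  qed
  then show "eval_y_minus_a (super_schur nu) n = double_schur nu n"
    by (simp add: eval_super_schur[OF assms])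
qed

end
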